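(* Let $r,n$ be positive integers with $r\equiv2\pmod4$. The function $L_A$ is the length function of $A_{r,n}$ with respect to the set of generators $\mathcal A$: for each $\pi\in A_{r,n}$, $$\ell_{\mathcal A}(\pi)=L_A(\pi),\qquad\text{where}\quad L_A(\pi)=\sum_{i:\,z_i(\pi)\neq0}(i-1)+\mathrm{inv}(\pi)+\sum_{i=1}^n\bigl(z_i(\pi)\oslash2\bigr).$$
   Context: $G_{r,n}=\mathbb{Z}_r\wr S_n$ is the set of pairs $(\vec z,\tau)$ with $\vec z=(z_1,\dots,z_n)\in\{0,\dots,r-1\}^n$, $\tau\in S_n$, with product $(\vec z,\tau)(\vec z',\tau')=((z_1+z'_{\tau^{-1}(1)},\dots,z_n+z'_{\tau^{-1}(n)}),\tau\circ\tau')$, addition mod $r$. For $\pi=(\vec z,\tau)$: $z_i(\pi)=z_i$ is the color of the digit $i$; $c_i(\pi)=z_{\tau(i)}$ is the color of the digit in place $i$; $\pi(i)=\tau(i)^{[c_i]}$ (color $0$ may be omitted). The generator $s_0$ is the pair with vector $(1,0,\dots,0)$ and identity permutation; for $1\le i\le n-1$, $s_i$ is the pair with zero vector and transposition $(i\ i+1)$. $A_{r,n}$ is the kernel of the homomorphism $G_{r,n}\to\{\pm1\}$ sending every $s_i$, $0\le i\le n-1$, to $-1$. Put $a_0=s_0^2$, $a_i=s_0^{r/2}s_i$ for $1\le i\le n-1$, and $\mathcal A=\{a_0,a_1,a_1^{-1},a_2,\dots,a_{n-1}\}$, a generating set of $A_{r,n}$. $\ell_{\mathcal A}(\pi)$ is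 the minimal $u$ such that $\pi$ is a product of $u$ elements of $\mathcal A$. For a nonnegative integer $a$, $a\oslash 2\in\{0,\dots,\frac r2-1\}$ is the residue modulo $\frac r2$ of $\frac a2$ if $a$ is even, and of $\frac{a+r/2}{2}$ if $a$ is odd. The length order on colored digits is $n^{[r-1]}<\cdots<n^{[1]}<\cdots<1^{[r-1]}<\cdots<1^{[1]}<1<2<\cdots<n$; $\mathrm{inv}(\pi)=|\{(i,j): i<j,\ \pi(i)>\pi(j)\}|$ in this order. *)

theory Defs
  imports "HOL-Algebra.Sym_Groups" "HOL-Algebra.Coset" "HOL-Library.Extended_Nat"
begin

section \<open>The colored permutation group\<close>

text \<open>
  Elements are pairs \<open>(z, \<tau>)\<close>, where the color vector \<open>z\<close> is an extensional function on
  \<open>{1..n}\<close> with values in \<open>{0..<r}\<close> and \<open>\<tau>\<close> is a permutation of \<open>{1..n}\<close>, regarded as a function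
  on all of \<open>nat\<close> that is the identity elsewhere.
\<close>

type_synonym cperm = "(nat \<Rightarrow> nat) \<times> (nat \<Rightarrow> nat)"

definition cperm_mult :: "nat \<Rightarrow> nat \<Rightarrow> cperm \<Rightarrow> cperm \<Rightarrow> cperm" where
  "cperm_mult r n p q =
     (\<lambda>i\<in>{1..n}. (fst p i + fst q (inv_into UNIV (snd p) i)) mod r, snd p \<circ> snd q)"

definition cperm_group :: "nat \<Rightarrow> nat \<Rightarrow> cperm monoid" where
  "cperm_group r n =
     \<lparr> carrier = ({1..n} \<rightarrow>\<^sub>E {0..<r}) \<times> {\<tau>. \<tau> permutes {1..n}},
       mult = cperm_mult r n,
       one = (\<lambda>i\<in>{1..n}. 0, id) \<rparr>"

definition cperm_s :: "nat \<Rightarrow> nat \<Rightarrow> cperm" where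
  "cperm_s n i = (if i = 0 then (\<lambda>j\<in>{1..n}. if j = 1 then 1 else 0, id)
            else (\<lambda>j\<in>{1..n}. 0, transpose i (i + 1)))"


section \<open>The alternating subgroup\<close>

text \<open>
  The codomain \<open>sign_img\<close> is the multiplicative group \<open>{-1, 1}\<close> of integers. The requirement
  of extensionality only fixes the values outside the carrier. Existence and uniqueness for
  even \<open>r\<close> are shown at the end of this theory.
\<close>

definition is_sign_char :: "nat \<Rightarrow> nat \<Rightarrow> (cperm \<Rightarrow> int) \<Rightarrow> bool" where
  "is_sign_char r n h \<longleftrightarrow>
     h \<in> hom (cperm_group r n) sign_img \<and> h \<in> extensional (carrier (cperm_group r n)) \<and>
     (\<forall>i<n. h (cperm_s n i) = -1)"

definition sign_char :: "nat \<Rightarrow> nat \<Rightarrow> cperm \<Rightarrow> int" where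
  "sign_char r n = (THE h. is_sign_char r n h)"

definition alt_cperms :: "nat \<Rightarrow> nat \<Rightarrow> cperm set" where
  "alt_cperms r n = kernel (cperm_group r n) sign_img (sign_char r n)"

definition alt_gen :: "nat \<Rightarrow> nat \<Rightarrow> nat \<Rightarrow> cperm" where
  "alt_gen r n i =
     (if i = 0 then cperm_s n 0 [^]\<^bsub>cperm_group r n\<^esub> (2::nat)
      else (cperm_s n 0 [^]\<^bsub>cperm_group r n\<^esub> (r div 2)) \<otimes>\<^bsub>cperm_group r n\<^esub> cperm_s n i)"

text \<open>For \<open>n = 1\<close> the element \<open>a\<^sub>1\<close> does not exist, so there is no inverse to add.\<close>

definition alt_gens :: "nat \<Rightarrow> nat \<Rightarrow> cperm set" where
  "alt_gens r n =
     alt_gen r n ` {..<n} \<union> (if n > 1 then {inv\<^bsub>cperm_group r n\<^esub> (alt_gen r n 1)} else {})"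


section \<open>Word length\<close>

text \<open>
  The minimal number of factors, the infimum being \<open>\<infinity>\<close> if the element is not a product
  of elements of \<open>S\<close>.
\<close>

definition word_length :: "('g, 'm) monoid_scheme \<Rightarrow> 'g set \<Rightarrow> 'g \<Rightarrow> enat" where
  "word_length G S x =
     (INF ws \<in> {ws. set ws \<subseteq> S \<and> foldr (mult G) ws \<one>\<^bsub>G\<^esub> = x}. enat (length ws))"


section \<open>The combinatorial length formula\<close>

text \<open>A colored digit \<open>d\<^sup>[\<^sup>c\<^sup>]\<close> is the pair \<open>(d, c)\<close>; \<open>length_less\<close> is the strict length order.\<close>

fun length_less :: "nat \<times> nat \<Rightarrow> nat \<times> nat \<Rightarrow> bool" where
  "length_less (d, c) (d', c') \<longleftrightarrow>
     (if c = 0 \<and> c' = 0 then d < d'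
      else if c = 0 then False
      else if c' = 0 then True
      else d > d' \<or> (d = d' \<and> c > c'))"

definition digit :: "cperm \<Rightarrow> nat \<Rightarrow> nat \<times> nat" where
  "digit p i = (snd p i, fst p (snd p i))"

definition inversions :: "nat \<Rightarrow> cperm \<Rightarrow> nat" where
  "inversions n p =
     card {(i, j). i \<in> {1..n} \<and> j \<in> {1..n} \<and> i < j \<and> length_less (digit p j) (digit p i)}"

definition half_mod :: "nat \<Rightarrow> nat \<Rightarrow> nat" where
  "half_mod r c = (if even c then c div 2 else (c + r div 2) div 2) mod (r div 2)"

definition L_A :: "nat \<Rightarrow> nat \<Rightarrow> cperm \<Rightarrow> nat" where
  "L_A r n p =
     (\<Sum>i \<in> {i \<in> {1..n}. fst p i \<noteq> 0}. i - 1) + inversions n p + (\<Sum>i = 1..n. half_mod r (fst p i))"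


section \<open>Existence and uniqueness of the sign character\<close>

lemma cperm_group_simps:
  "p \<in> carrier (cperm_group r n) \<longleftrightarrow> fst p \<in> {1..n} \<rightarrow>\<^sub>E {0..<r} \<and> snd p permutes {1..n}"
  "mult (cperm_group r n) = cperm_mult r n"
  "one (cperm_group r n) = (\<lambda>i\<in>{1..n}. 0, id)"
  by (auto simp: cperm_group_def mem_Times_iff)

lemma permutes_inv_mem: "\<tau> permutes A \<Longrightarrow> inv' \<tau> i \<in> A \<longleftrightarrow> i \<in> A"
  by (rule permutes_in_image[OF permutes_inv])

lemma cperm_mult_closed:
  assumes "r > 0" "p \<in> carrier (cperm_group r n)" "q \<in> carrier (cperm_group r n)"
  shows "cperm_mult r n p q \<in> carrier (cperm_group r n)"
  using assms by (auto simp: cperm_group_simps cperm_mult_def permutes_compose)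

lemma cperm_group_is_group:
  assumes r: "r > 0"
  shows "group (cperm_group r n)"
proof (rule groupI, unfold cperm_group_simps(2,3))
  fix p q w
  assume p: "p \<in> carrier (cperm_group r n)" and q: "q \<in> carrier (cperm_group r n)"
    and w: "w \<in> carrier (cperm_group r n)"
  have bij: "bij (snd p)" "bij (snd q)"
    using p q by (auto simp: cperm_group_simps permutes_bij)
  have perm: "snd p permutes {1..n}"
    using p by (simp add: cperm_group_simps)
  show "cperm_mult r n (cperm_mult r n p q) w = cperm_mult r n p (cperm_mult r n q w)"
    unfolding cperm_mult_def prod.inject fst_conv snd_conv o_inv_distrib[OF bij]
    using permutes_inv_mem[OF perm]
    by (simp add: mod_simps add.assoc comp_assoc del: atLeastAtMost_iff cong: restrict_cong)
next
  fix p assume p: "p \<in> carrier (cperm_group r n)"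
  have perm: "snd p permutes {1..n}" and fst: "fst p \<in> {1..n} \<rightarrow>\<^sub>E {0..<r}"
    using p by (simp_all add: cperm_group_simps)
  have *: "(\<lambda>i\<in>{1..n}. fst p i mod r) = fst p"
    using fst by (auto simp: fun_eq_iff restrict_def PiE_def Pi_def extensional_def)
  show "cperm_mult r n (\<lambda>i\<in>{1..n}. 0, id) p = p"
    using * by (cases p) (simp add: cperm_mult_def cong: restrict_cong)
  define q where "q = (\<lambda>i\<in>{1..n}. (r - fst p (snd p i)) mod r, inv' (snd p))"
  have q: "q \<in> carrier (cperm_group r n)"
    using r perm by (auto simp: q_def cperm_group_simps permutes_inv)
  have "((r - fst p (snd p i)) mod r + fst p (snd p i)) mod r = 0" if i: "i \<in> {1..n}" for i
  proof -
    have "snd p i \<in> {1..n}"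
      using permutes_in_image[OF perm, of i] i by blast
    then have "fst p (snd p i) < r"
      using PiE_mem[OF fst] by fastforce
    then show ?thesis
      by (simp add: mod_simps)
  qed
  then have "cperm_mult r n q p = (\<lambda>i\<in>{1..n}. 0, id)"
    using perm by (auto simp: cperm_mult_def q_def permutes_inv_inv permutes_inv_o intro!: restrict_ext)
  then show "\<exists>q\<in>carrier (cperm_group r n). cperm_mult r n q p = (\<lambda>i\<in>{1..n}. 0, id)"
    using q by blast
qed (rule cperm_mult_closed[OF r], assumption+, use r in \<open>simp add: cperm_group_simps\<close>)

definition color_sum_sign :: "nat \<Rightarrow> nat \<Rightarrow> cperm \<Rightarrow> int" where
  "color_sum_sign r n =
     (\<lambda>p\<in>carrier (cperm_group r n). (-1) ^ (\<Sum>i = 1..n. fst p i) * sign (snd p))"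

lemma is_sign_char_color_sum_sign:
  assumes r: "even r" "r > 0"
  shows "is_sign_char r n (color_sum_sign r n)"
proof -
  have par: "(-1) ^ (\<Sum>i\<in>A. f i mod r) = (-1 :: int) ^ (\<Sum>i\<in>A. f i)"
    if "finite A" for A and f :: "nat \<Rightarrow> nat"
    using that by (induction A) (use r in \<open>auto simp: power_add uminus_power_if dvd_mod_iff\<close>)
  have "color_sum_sign r n (cperm_mult r n p q) = color_sum_sign r n p * color_sum_sign r n q"
    if p: "p \<in> carrier (cperm_group r n)" and q: "q \<in> carrier (cperm_group r n)" for p q
  proof -
    have perm: "snd p permutes {1..n}" "snd q permutes {1..n}"
      using p q by (simp_all add: cperm_group_simps)
    have "(\<Sum>i = 1..n. fst q (inv' (snd p) i)) = (\<Sum>i = 1..n. fst q i)"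
      using sum.permute[OF permutes_inv[OF perm(1)], of "fst q"] by (simp add: o_def)
    moreover have "sign (snd p \<circ> snd q) = sign (snd p) * sign (snd q)"
      using perm by (intro sign_compose) (auto simp: permutation_permutes)
    ultimately show ?thesis
      using p q cperm_mult_closed[OF r(2) p q]
      by (simp add: color_sum_sign_def cperm_mult_def par sum.distrib power_add)
  qed
  moreover have "color_sum_sign r n (cperm_s n i) = -1" if i: "i < n" for i
  proof -
    have "r \<ge> 2" using r by (auto elim!: evenE)
    then have "cperm_s n i \<in> carrier (cperm_group r n)"
      using i by (auto simp: cperm_group_simps cperm_s_def permutes_id intro: permutes_swap_id)
    then show ?thesis
      using i by (simp add: color_sum_sign_def cperm_s_def sign_swap_id sign_id)
  qed
  ultimately show ?thesis
    by (auto simp: is_sign_char_def hom_def sign_img_def cperm_group_simps(2) color_sum_sign_def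
        sign_def uminus_power_if)
qed

lemma is_sign_char_unique:
  assumes r: "r \<ge> 2" and g: "is_sign_char r n g" and h: "is_sign_char r n h"
  shows "g = h"
proof -
  let ?G = "cperm_group r n"
  interpret G: group ?G
    using r by (intro cperm_group_is_group) simp
  define E where "E = {p \<in> carrier ?G. g p = h p}"
  have gh: "g \<in> hom ?G sign_img" "h \<in> hom ?G sign_img" "g \<in> extensional (carrier ?G)"
    "h \<in> extensional (carrier ?G)"
    using g h by (auto simp: is_sign_char_def)
  have one: "(\<lambda>i\<in>{1..n}. 0, id) \<in> E"
  proof -
    have "g (one ?G) = h (one ?G)"
      using hom_one[OF gh(1)] hom_one[OF gh(2)] G.is_group sign_img_is_group by simp
    then show ?thesis
      using r by (auto simp: E_def cperm_group_simps permutes_id)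
  qed
  have mult: "cperm_mult r n p q \<in> E" if "p \<in> E" "q \<in> E" for p q
    using that hom_mult[OF gh(1), of p q] hom_mult[OF gh(2), of p q] r
    by (auto simp: E_def cperm_mult_closed cperm_group_simps(2))
  have s: "cperm_s n i \<in> E" if "i < n" for i
    using that g h r
    by (auto simp: E_def is_sign_char_def cperm_group_simps cperm_s_def permutes_id intro: permutes_swap_id)
  define perm where "perm \<tau> = ((\<lambda>i\<in>{1..n}. 0 :: nat), \<tau>)" for \<tau> :: "nat \<Rightarrow> nat"
  have perm_comp: "perm (\<sigma> \<circ> \<tau>) \<in> E" if "perm \<sigma> \<in> E" "perm \<tau> \<in> E" for \<sigma> \<tau>
  proof -
    have "\<sigma> permutes {1..n}"
      using that by (simp add: E_def cperm_group_simps perm_def)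
    then have "cperm_mult r n (perm \<sigma>) (perm \<tau>) = perm (\<sigma> \<circ> \<tau>)"
      using permutes_inv_mem[of \<sigma> "{1..n}"] by (simp add: cperm_mult_def perm_def cong: restrict_cong)
    then show ?thesis
      using mult[OF that] by simp
  qed
  have adj: "perm (transpose i (Suc i)) \<in> E" if "1 \<le> i" "i < n" for i
    using s[of i] that by (simp add: cperm_s_def perm_def)
  have swap: "perm (transpose i (i + Suc k)) \<in> E" if "1 \<le> i" "i + Suc k \<le> n" for i k
    using that
  proof (induction k)
    case 0
    then show ?case using adj[of i] by simp
  next
    case (Suc k)
    let ?t = "transpose (i + Suc k) (Suc (i + Suc k))"
    have "perm (?t \<circ> transpose i (i + Suc k) \<circ> ?t) \<in> E"
      using Suc adj[of "i + Suc k"] by (intro perm_comp) auto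
    moreover have "?t \<circ> transpose i (i + Suc k) \<circ> ?t = transpose i (i + Suc (Suc k))"
      by (auto simp: fun_eq_iff transpose_def)
    ultimately show ?case by simp
  qed
  have swap': "perm (transpose i j) \<in> E" if "i \<in> {1..n}" "j \<in> {1..n}" "i < j" for i j
    using swap[of i "j - Suc i"] that by simp
  have perms: "perm \<tau> \<in> E" if "\<tau> permutes {1..n}" for \<tau>
    using that finite_atLeastAtMost
  proof (induction \<tau> rule: permutes_induct)
    case id
    then show ?case using one by (simp add: perm_def id_def)
  next
    case (swap i j \<tau>)
    then have "perm (transpose i j) \<in> E"
      using swap'[of i j] swap'[of j i] by (cases "i < j") (auto simp: transpose_commute)
    then show ?case using swap perm_comp by blast
  qed
  define colors where "colors f = ((\<lambda>i\<in>{1..n}. f i mod r), id :: nat \<Rightarrow> nat)" for f :: "nat \<Rightarrow> nat"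
  have colors_add: "colors (\<lambda>i. f i + f' i) \<in> E" if "colors f \<in> E" "colors f' \<in> E" for f f'
  proof -
    have "cperm_mult r n (colors f) (colors f') = colors (\<lambda>i. f i + f' i)"
      by (auto simp: cperm_mult_def colors_def mod_simps intro!: restrict_ext)
    then show ?thesis
      using mult[OF that] by simp
  qed
  have unit: "colors (\<lambda>j. if j = i then 1 else 0) \<in> E" if i: "i \<in> {1..n}" for i
  proof -
    have n: "n > 0" "1 \<in> {1..n}" using i by auto
    let ?t = "transpose 1 i"
    have t: "?t permutes {1..n}"
      using permutes_swap_id[OF n(2) i] .
    have "cperm_mult r n (cperm_mult r n (perm ?t) (cperm_s n 0)) (perm ?t) \<in> E"
      by (intro mult perms t s n)
    also have "cperm_mult r n (cperm_mult r n (perm ?t) (cperm_s n 0)) (perm ?t) =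
        colors (\<lambda>j. if j = i then 1 else 0)"
      using n i r by (auto simp: cperm_mult_def cperm_s_def perm_def colors_def transpose_def
          fun_eq_iff)
    finally show ?thesis .
  qed
  have single: "colors (\<lambda>j. if j = i then c else 0) \<in> E" if i: "i \<in> {1..n}" for i c
  proof (induction c)
    case 0
    then show ?case using one by (simp add: colors_def cong: if_cong)
  next
    case (Suc c)
    have "(\<lambda>j. if j = i then Suc c else 0) =
        (\<lambda>j. (if j = i then c else 0) + (if j = i then 1 else 0))" by auto
    then show ?case using colors_add[OF Suc unit[OF i]] by simp
  qed
  have many: "colors (\<lambda>i. if i \<in> A then f i else 0) \<in> E" if "finite A" "A \<subseteq> {1..n}" for A f
    using that
  proof (induction A rule: finite_induct)
    case empty
    then show ?case using one by (simp add: colors_def)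
  next
    case (insert k A)
    have "(\<lambda>i. if i \<in> insert k A then f i else 0) =
        (\<lambda>i. (if i = k then f k else 0) + (if i \<in> A then f i else 0))"
      using insert by auto
    then show ?case
      using colors_add[OF single[of k "f k"] insert.IH] insert by simp
  qed
  have "p \<in> E" if p: "p \<in> carrier ?G" for p
  proof -
    have "cperm_mult r n (colors (\<lambda>i. if i \<in> {1..n} then fst p i else 0)) (perm (snd p)) \<in> E"
      using p by (intro mult many perms) (auto simp: cperm_group_simps)
    also have "cperm_mult r n (colors (\<lambda>i. if i \<in> {1..n} then fst p i else 0)) (perm (snd p)) = p"
    proof -
      have "(\<lambda>i\<in>{1..n}. fst p i mod r) = fst p"
        using p by (auto simp: cperm_group_simps fun_eq_iff restrict_def PiE_def Pi_def extensional_def)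
      then show ?thesis
        by (cases p) (simp add: cperm_mult_def colors_def perm_def cong: restrict_cong)
    qed
    finally show ?thesis .
  qed
  then show ?thesis
    using gh by (intro extensionalityI[of _ "carrier ?G"]) (auto simp: E_def)
qed

lemma sign_char_ex1:
  assumes "even r" "r > 0"
  shows "\<exists>!h. is_sign_char r n h"
proof -
  have "r \<ge> 2" using assms by (auto elim!: evenE)
  then show ?thesis
    using is_sign_char_color_sum_sign[OF assms] is_sign_char_unique by blast
qed

end

theory Submission
  imports Defs
begin

text \<open>
  Write \<open>h = r / 2\<close>, which is odd, and let generators act from the right. Multiplication by a
  power of \<open>s\<^sub>0\<close> only recolors the digit in the first place. This changes the first sum
  and the inversion number by opposite amounts, so \<open>L\<^sub>A\<close> changes only through \<open>z \<oslash> 2\<close>. Modulo \<open>h\<close>,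
  \<open>z \<oslash> 2\<close> is multiplication of \<open>z\<close> by the inverse of \<open>2\<close>; hence \<open>s\<^sub>0\<^sup>h\<close> preserves \<open>L\<^sub>A\<close> and
  \<open>s\<^sub>0\<^sup>2\<close> raises it by at most one. Multiplication by \<open>s\<^sub>i\<close> changes \<open>inv\<close> by exactly
  one. Thus every generator raises \<open>L\<^sub>A\<close> by at most one. Conversely, if no generator lowers
  \<open>L\<^sub>A\<close> at \<open>\<pi>\<close>, then the first color is \<open>0\<close> or \<open>h\<close>, and neither \<open>\<pi>\<close> nor \<open>\<pi> s\<^sub>0\<^sup>h\<close> has a
  descent in the first place, nor \<open>\<pi>\<close> anywhere else. Then the one of the two whose first color
  is \<open>0\<close> is increasing, so it is the identity, and the parity of \<open>h\<close> excludes \<open>\<pi> = s\<^sub>0\<^sup>h\<close>.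
\<close>

section \<open>Word length from a length function\<close>

context monoid
begin

lemma foldr_mult_closed:
  "set ws \<subseteq> carrier G \<Longrightarrow> foldr (\<otimes>) ws \<one> \<in> carrier G"
  by (induction ws) auto

text \<open>Words are folded from the left end, whereas the induction below adds and removes letters
  at the right end; this lemma is the bridge.\<close>

lemma foldr_mult_snoc:
  assumes "set ws \<subseteq> carrier G" "s \<in> carrier G"
  shows "foldr (\<otimes>) (ws @ [s]) \<one> = foldr (\<otimes>) ws \<one> \<otimes> s"
  using assms(1)
proof (induction ws)
  case (Cons w ws)
  have "foldr (\<otimes>) (ws @ [s]) \<one> = foldr (\<otimes>) ws \<one> \<otimes> s"
    using Cons by simp
  then show ?case
    using Cons.prems assms(2) foldr_mult_closed[of ws] by (simp add: m_assoc)
qed (use assms(2) in simp)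

text \<open>For the upper bound, \<open>descend\<close> splits off last letters; \<open>f\<close>
  drops each time, so at most \<open>f x\<close> letters come off before \<open>\<one>\<close> is
  reached. For the lower bound, \<open>f_mult\<close> is summed along the prefixes of a word. The
  descent stays inside \<open>H\<close>, whereas \<open>f_mult\<close> covers the whole carrier, to
  which all prefixes belong.\<close>

lemma word_length_eqI:
  fixes f :: "'a \<Rightarrow> nat"
  assumes S: "S \<subseteq> carrier G"
    and f_one: "f \<one> = 0"
    and f_mult: "\<And>x s. x \<in> carrier G \<Longrightarrow> s \<in> S \<Longrightarrow> f (x \<otimes> s) \<le> Suc (f x)"
    and descend: "\<And>x. x \<in> H \<Longrightarrow> x \<noteq> \<one> \<Longrightarrow> \<exists>s\<in>S. \<exists>y\<in>H. x = y \<otimes> s \<and> f y < f x"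
    and x: "x \<in> H"
  shows "word_length G S x = enat (f x)"
proof (rule antisym)
  have "\<exists>ws. set ws \<subseteq> S \<and> foldr (\<otimes>) ws \<one> = x \<and> length ws \<le> f x"
    using x
  proof (induction "f x" arbitrary: x rule: less_induct)
    case less
    show ?case
    proof (cases "x = \<one>")
      case True
      then show ?thesis by (intro exI[of _ "[]"]) simp
    next
      case False
      then obtain s y where sy: "s \<in> S" "y \<in> H" "x = y \<otimes> s" "f y < f x"
        using descend less.prems by blast
      then obtain ws where "set ws \<subseteq> S" "foldr (\<otimes>) ws \<one> = y" "length ws \<le> f y"
        using less.hyps by blast
      moreover have "foldr (\<otimes>) (ws @ [s]) \<one> = foldr (\<otimes>) ws \<one> \<otimes> s"
        using calculation sy S by (intro foldr_mult_snoc) auto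
      ultimately show ?thesis
        using sy by (intro exI[of _ "ws @ [s]"]) simp
    qed
  qed
  then obtain ws where "set ws \<subseteq> S" "foldr (\<otimes>) ws \<one> = x" "length ws \<le> f x"
    by blast
  then show "word_length G S x \<le> enat (f x)"
    unfolding word_length_def by (intro INF_lower2[of ws]) auto
next
  have "f (foldr (\<otimes>) ws \<one>) \<le> length ws" if "set ws \<subseteq> S" for ws
    using that
  proof (induction ws rule: rev_induct)
    case Nil
    then show ?case using f_one by simp
  next
    case (snoc s ws)
    then have "set ws \<subseteq> carrier G" "s \<in> carrier G" "s \<in> S"
      using S by auto
    then have "f (foldr (\<otimes>) (ws @ [s]) \<one>) \<le> Suc (f (foldr (\<otimes>) ws \<one>))"
      using f_mult foldr_mult_closed foldr_mult_snoc by metis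
    then show ?case using snoc by simp
  qed
  then show "enat (f x) \<le> word_length G S x"
    unfolding word_length_def by (intro INF_greatest) auto
qed

end


section \<open>Inversions\<close>

text \<open>Exchanging \<open>i\<close> and \<open>Suc i\<close> in both coordinates maps the
  inversions other than \<open>(i, Suc i)\<close> injectively to inversions of the swapped sequence.
  The pair \<open>(i, Suc i)\<close> itself is an inversion of exactly one of the two sequences, by
  \<open>R\<close>.\<close>

lemma card_inversions_swap:
  fixes f :: "nat \<Rightarrow> 'a"
  assumes i: "1 \<le> i" "i < n"
    and R: "R (f i) (f (Suc i)) \<longleftrightarrow> \<not> R (f (Suc i)) (f i)"
  defines "Inv \<equiv> \<lambda>f. {(a, b). a \<in> {1..n} \<and> b \<in> {1..n} \<and> a < b \<and> R (f b) (f a)}"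
  shows "R (f (Suc i)) (f i) \<Longrightarrow> card (Inv f) = Suc (card (Inv (f \<circ> transpose i (Suc i))))"
    and "\<not> R (f (Suc i)) (f i) \<Longrightarrow> card (Inv (f \<circ> transpose i (Suc i))) = Suc (card (Inv f))"
proof -
  let ?t = "transpose i (Suc i)" and ?e = "(i, Suc i)"
  have fin: "finite (Inv g)" for g :: "nat \<Rightarrow> 'a"
    by (rule finite_subset[of _ "{1..n} \<times> {1..n}"]) (auto simp: Inv_def)
  have sub: "map_prod ?t ?t ` (Inv g - {?e}) \<subseteq> Inv (g \<circ> ?t) - {?e}" for g :: "nat \<Rightarrow> 'a"
  proof -
    have "?t a < ?t b" if "a < b" "(a, b) \<noteq> ?e" for a b
      using that by (auto simp: transpose_def)
    moreover have "?t a \<in> {1..n} \<longleftrightarrow> a \<in> {1..n}" for a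
      using i by (auto simp: transpose_def)
    moreover have "(?t a, ?t b) \<noteq> ?e" if "a < b" for a b
      using that by (auto simp: transpose_def split: if_splits)
    ultimately show ?thesis
      by (auto simp: Inv_def simp del: atLeastAtMost_iff)
  qed
  have le: "card (Inv g - {?e}) \<le> card (Inv (g \<circ> ?t) - {?e})" for g :: "nat \<Rightarrow> 'a"
  proof -
    have "inj_on (map_prod ?t ?t) (Inv g - {?e})"
      by (rule inj_on_subset[OF _ subset_UNIV]) (simp add: prod.inj_map)
    then show ?thesis
      using sub[of g] fin by (metis card_inj_on_le finite_Diff)
  qed
  \<comment> \<open>The transposition is an involution, so the inequality for
    \<open>f \<circ> ?t\<close> is the reverse of the one for \<open>f\<close>.\<close>
  have eq: "card (Inv f - {?e}) = card (Inv (f \<circ> ?t) - {?e})"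
    using le[of f] le[of "f \<circ> ?t"] by (simp add: comp_assoc)
  have mem: "?e \<in> Inv f \<longleftrightarrow> R (f (Suc i)) (f i)" "?e \<in> Inv (f \<circ> ?t) \<longleftrightarrow> R (f i) (f (Suc i))"
    using i by (auto simp: Inv_def)
  show "card (Inv f) = Suc (card (Inv (f \<circ> ?t)))" if "R (f (Suc i)) (f i)"
    using that eq mem R fin card_Suc_Diff1[of "Inv f" ?e] by (simp add: Diff_triv)
  show "card (Inv (f \<circ> ?t)) = Suc (card (Inv f))" if "\<not> R (f (Suc i)) (f i)"
    using that eq mem R fin card_Suc_Diff1[of "Inv (f \<circ> ?t)" ?e] by (simp add: Diff_triv)
qed

lemma length_less_total: "d \<noteq> d' \<Longrightarrow> length_less (d, c) (d', c') \<longleftrightarrow> \<not> length_less (d', c') (d, c)"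
  by auto

lemma inversions_eq_sum:
  "inversions n p =
     (\<Sum>i = 1..n. card {j \<in> {1..n}. i < j \<and> length_less (digit p j) (digit p i)})"
proof -
  have "{(i, j). i \<in> {1..n} \<and> j \<in> {1..n} \<and> i < j \<and> length_less (digit p j) (digit p i)} =
      (SIGMA i:{1..n}. {j \<in> {1..n}. i < j \<and> length_less (digit p j) (digit p i)})"
    by auto
  then show ?thesis
    by (simp add: inversions_def)
qed

section \<open>The part of the length that ignores the color of the first digit\<close>

definition color_inversions :: "nat \<Rightarrow> cperm \<Rightarrow> nat" where
  "color_inversions n p = (\<Sum>i \<in> {i \<in> {1..n}. fst p i \<noteq> 0}. i - 1) + inversions n p"

text \<open>The right side does not involve the color of \<open>d\<close>. In the length order an
  uncolored \<open>d\<close> exceeds all digits below it, whatever their color, and the colored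
  digits above it. A colored \<open>d\<close> exceeds only the latter, and the term
  \<open>d - 1\<close> makes up for the loss.\<close>

lemma first_place_inversions:
  assumes "n > 0" and perm: "snd p permutes {1..n}"
  defines "d \<equiv> snd p 1"
  shows "(if fst p d \<noteq> 0 then d - 1 else 0) +
      card {j \<in> {1..n}. 1 < j \<and> length_less (digit p j) (digit p 1)} =
    (d - 1) + card {e \<in> {1..n}. d < e \<and> fst p e \<noteq> 0}"
proof -
  let ?B = "{e \<in> {1..n}. length_less (e, fst p e) (d, fst p d)}"
  let ?C = "{e \<in> {1..n}. d < e \<and> fst p e \<noteq> 0}"
  have d: "d \<in> {1..n}"
    using permutes_in_image[OF perm, of 1] assms(1) by (simp add: d_def)
  \<comment> \<open>The count is moved from places to digits; by injectivity, leaving place 1 means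
    leaving the digit \<open>d\<close>.\<close>
  have "snd p ` {j \<in> {1..n}. 1 < j \<and> length_less (digit p j) (digit p 1)} =
      {e \<in> snd p ` {1..n}. e \<noteq> d \<and> length_less (e, fst p e) (d, fst p d)}"
  proof -
    have "1 < j \<longleftrightarrow> snd p j \<noteq> d" if "j \<in> {1..n}" for j
      using that inj_eq[OF permutes_inj[OF perm]] by (auto simp: d_def)
    then show ?thesis
      unfolding digit_def d_def[symmetric] by blast
  qed
  also have "\<dots> = ?B"
    using permutes_image[OF perm] by auto
  finally have img: "card {j \<in> {1..n}. 1 < j \<and> length_less (digit p j) (digit p 1)} = card ?B"
    using card_image[OF inj_on_subset[OF permutes_inj[OF perm] subset_UNIV],
        of "{j \<in> {1..n}. 1 < j \<and> length_less (digit p j) (digit p 1)}"] by simp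
  show ?thesis
  proof (cases "fst p d = 0")
    case True
    have "?B = {1..<d} \<union> ?C"
    proof (rule Set.set_eqI)
      fix e
      show "e \<in> ?B \<longleftrightarrow> e \<in> {1..<d} \<union> ?C"
        using True d by (cases e d rule: linorder_cases) auto
    qed
    moreover have "card ({1..<d} \<union> ?C) = card {1..<d} + card ?C"
      by (rule card_Un_disjoint) auto
    ultimately show ?thesis
      using True img by simp
  next
    case False
    then have "?B = ?C"
      by auto
    then show ?thesis
      using False img by simp
  qed
qed

text \<open>None of the three summands sees the color of \<open>d\<close>: the first omits
  \<open>d\<close>, the second looks at larger digits only, and the third compares places from the
  second on.\<close>

lemma color_inversions_first_place:
  assumes n: "n > 0" and perm: "snd p permutes {1..n}"
  defines "d \<equiv> snd p 1"
  shows "color_inversions n p =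
    (\<Sum>i \<in> {i \<in> {1..n}. i \<noteq> d \<and> fst p i \<noteq> 0}. i - 1) +
    ((d - 1) + card {e \<in> {1..n}. d < e \<and> fst p e \<noteq> 0}) +
    (\<Sum>i \<in> {2..n}. card {j \<in> {1..n}. i < j \<and> length_less (digit p j) (digit p i)})"
proof -
  have d: "d \<in> {1..n}"
    using permutes_in_image[OF perm, of 1] n by (simp add: d_def)
  have "(\<Sum>i \<in> {i \<in> {1..n}. fst p i \<noteq> 0}. i - 1) =
      (\<Sum>i \<in> {i \<in> {1..n}. i \<noteq> d \<and> fst p i \<noteq> 0}. i - 1) + (if fst p d \<noteq> 0 then d - 1 else 0)"
  proof (cases "fst p d = 0")
    case True
    then have "{i \<in> {1..n}. fst p i \<noteq> 0} = {i \<in> {1..n}. i \<noteq> d \<and> fst p i \<noteq> 0}"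
      by auto
    then show ?thesis using True by simp
  next
    case False
    then have "{i \<in> {1..n}. fst p i \<noteq> 0} = insert d {i \<in> {1..n}. i \<noteq> d \<and> fst p i \<noteq> 0}"
      using d by auto
    then show ?thesis using False by simp
  qed
  moreover have "inversions n p =
      card {j \<in> {1..n}. 1 < j \<and> length_less (digit p j) (digit p 1)} +
      (\<Sum>i \<in> {2..n}. card {j \<in> {1..n}. i < j \<and> length_less (digit p j) (digit p i)})"
    unfolding inversions_eq_sum using n
    by (subst sum.atLeast_Suc_atMost) (auto simp: numeral_2_eq_2)
  ultimately show ?thesis
    using first_place_inversions[OF n perm] unfolding color_inversions_def d_def by linarith
qed

lemma color_inversions_cong:
  assumes n: "n > 0" and perm: "snd p permutes {1..n}" and q: "snd q = snd p"
    and agree: "\<And>i. i \<noteq> snd p 1 \<Longrightarrow> i \<in> {1..n} \<Longrightarrow> fst q i = fst p i"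
  shows "color_inversions n q = color_inversions n p"
proof -
  have digit: "digit q j = digit p j" if "j \<in> {2..n}" for j
    using that agree[of "snd p j"] permutes_in_image[OF perm, of j] inj_eq[OF permutes_inj[OF perm]]
    by (auto simp: digit_def q)
  have "{i \<in> {1..n}. i \<noteq> snd p 1 \<and> fst q i \<noteq> 0} = {i \<in> {1..n}. i \<noteq> snd p 1 \<and> fst p i \<noteq> 0}"
    "{e \<in> {1..n}. snd p 1 < e \<and> fst q e \<noteq> 0} = {e \<in> {1..n}. snd p 1 < e \<and> fst p e \<noteq> 0}"
    using agree by auto
  moreover have "(\<Sum>i \<in> {2..n}. card {j \<in> {1..n}. i < j \<and> length_less (digit q j) (digit q i)}) =
      (\<Sum>i \<in> {2..n}. card {j \<in> {1..n}. i < j \<and> length_less (digit p j) (digit p i)})"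
    using digit by (intro sum.cong arg_cong[where f = card]) auto
  ultimately show ?thesis
    using color_inversions_first_place[OF n perm] color_inversions_first_place[OF n, of q] perm q
    by simp
qed

lemma L_A_eq: "L_A r n p = color_inversions n p + (\<Sum>i = 1..n. half_mod r (fst p i))"
  by (simp add: L_A_def color_inversions_def)


section \<open>Right multiplication\<close>

definition recolor :: "nat \<Rightarrow> nat \<Rightarrow> cperm \<Rightarrow> cperm" where
  "recolor r k p = ((fst p)(snd p 1 := (fst p (snd p 1) + k) mod r), snd p)"

text \<open>Colors are indexed by digits, not by places, so moving digits between places leaves the
  color vector alone.\<close>

definition swap_places :: "nat \<Rightarrow> cperm \<Rightarrow> cperm" where
  "swap_places i p = (fst p, snd p \<circ> transpose i (Suc i))"

lemma digit_swap_places: "digit (swap_places i p) = digit p \<circ> transpose i (Suc i)"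
  by (auto simp: digit_def swap_places_def)

lemma digit_recolor:
  "snd p permutes {1..n} \<Longrightarrow> j \<noteq> 1 \<Longrightarrow> digit (recolor r k p) j = digit p j"
  using inj_eq[OF permutes_inj] by (fastforce simp: digit_def recolor_def)

lemma cperm_fst_less:
  "p \<in> carrier (cperm_group r n) \<Longrightarrow> i \<in> {1..n} \<Longrightarrow> fst p i < r"
  using PiE_mem[of "fst p" "{1..n}" "\<lambda>_. {0..<r}" i] by (simp add: cperm_group_simps)

lemma cperm_fst_restrict:
  "p \<in> carrier (cperm_group r n) \<Longrightarrow> restrict (fst p) {1..n} = fst p"
  by (auto simp: cperm_group_simps PiE_def extensional_restrict)

lemma cperm_s_closed: "r > 1 \<Longrightarrow> i < n \<Longrightarrow> cperm_s n i \<in> carrier (cperm_group r n)"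
  by (auto simp: cperm_group_simps cperm_s_def permutes_id intro: permutes_swap_id)

lemma cperm_s_0_pow:
  assumes "r > 0"
  shows "cperm_s n 0 [^]\<^bsub>cperm_group r n\<^esub> k = (\<lambda>j\<in>{1..n}. if j = 1 then k mod r else 0, id)"
proof (induction k)
  case 0
  show ?case
    by (auto simp: cperm_group_simps intro!: restrict_ext)
next
  case (Suc k)
  have "cperm_s n 0 [^]\<^bsub>cperm_group r n\<^esub> Suc k =
      cperm_mult r n (\<lambda>j\<in>{1..n}. if j = 1 then k mod r else 0, id) (cperm_s n 0)"
    by (simp only: nat_pow_Suc Suc cperm_group_simps)
  also have "\<dots> = (\<lambda>j\<in>{1..n}. if j = 1 then Suc k mod r else 0, id)"
    by (auto simp: cperm_mult_def cperm_s_def mod_Suc_eq intro!: restrict_ext)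
  finally show ?case .
qed

lemma cperm_mult_s_0_pow:
  assumes "n > 0" and p: "p \<in> carrier (cperm_group r n)" and "r > 0"
  shows "p \<otimes>\<^bsub>cperm_group r n\<^esub> (cperm_s n 0 [^]\<^bsub>cperm_group r n\<^esub> k) = recolor r k p"
proof -
  have perm: "snd p permutes {1..n}"
    using p by (simp add: cperm_group_simps)
  have d: "snd p 1 \<in> {1..n}"
    using permutes_in_image[OF perm, of 1] assms by simp
  \<comment> \<open>The color vector of the right factor is supported at 1; the product shifts this
    support to the digit in the first place.\<close>
  have "inv' (snd p) i = 1 \<longleftrightarrow> i = snd p 1" for i
    using permutes_inv_eq[OF perm] by auto
  then have "(\<lambda>i\<in>{1..n}. (fst p i + (if inv' (snd p) i = 1 then k mod r else 0)) mod r) =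
      restrict (fst (recolor r k p)) {1..n}"
    using cperm_fst_less[OF p] by (auto simp: recolor_def mod_simps intro!: restrict_ext)
  also have "\<dots> = fst (recolor r k p)"
    using cperm_fst_restrict[OF p] d
    by (auto simp: recolor_def fun_eq_iff restrict_def split: if_splits)
  finally have "(\<lambda>i\<in>{1..n}. (fst p i + (if inv' (snd p) i = 1 then k mod r else 0)) mod r) =
      fst (recolor r k p)" .
  moreover have "(\<lambda>i\<in>{1..n}. (fst p i + (\<lambda>j\<in>{1..n}. if j = 1 then k mod r else 0) (inv' (snd p) i)) mod r)
     = (\<lambda>i\<in>{1..n}. (fst p i + (if inv' (snd p) i = 1 then k mod r else 0)) mod r)"
    using permutes_inv_mem[OF perm] by (intro restrict_ext) auto
  ultimately show ?thesis
    by (simp add: cperm_s_0_pow[OF \<open>r > 0\<close>] cperm_group_simps cperm_mult_def recolor_def)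
qed

lemma cperm_mult_s:
  assumes p: "p \<in> carrier (cperm_group r n)" and "i > 0"
  shows "p \<otimes>\<^bsub>cperm_group r n\<^esub> cperm_s n i = swap_places i p"
proof -
  have perm: "snd p permutes {1..n}"
    using p by (simp add: cperm_group_simps)
  have "(\<lambda>j\<in>{1..n}. (fst p j + (\<lambda>j\<in>{1..n}. 0) (inv' (snd p) j)) mod r) = restrict (fst p) {1..n}"
    using permutes_inv_mem[OF perm] cperm_fst_less[OF p] by (intro restrict_ext) auto
  then show ?thesis
    using \<open>i > 0\<close> cperm_fst_restrict[OF p]
    by (simp add: cperm_group_simps(2) cperm_mult_def cperm_s_def swap_places_def)
qed

text \<open>The two color sums depend on the color vector only, so just the inversion number
  changes.\<close>

lemma L_A_swap_places:
  assumes p: "p \<in> carrier (cperm_group r n)" and i: "1 \<le> i" "i < n"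
  shows "length_less (digit p (Suc i)) (digit p i) \<Longrightarrow> L_A r n p = Suc (L_A r n (swap_places i p))"
    and "\<not> length_less (digit p (Suc i)) (digit p i) \<Longrightarrow> L_A r n (swap_places i p) = Suc (L_A r n p)"
proof -
  have "snd p i \<noteq> snd p (Suc i)"
    using p inj_eq[OF permutes_inj] by (fastforce simp: cperm_group_simps)
  then have tot: "length_less (digit p i) (digit p (Suc i)) \<longleftrightarrow>
      \<not> length_less (digit p (Suc i)) (digit p i)"
    unfolding digit_def by (rule length_less_total)
  note swap = card_inversions_swap[where R = length_less and f = "digit p", OF i tot]
  show "length_less (digit p (Suc i)) (digit p i) \<Longrightarrow> L_A r n p = Suc (L_A r n (swap_places i p))"
    using swap(1) by (simp add: L_A_def inversions_def digit_swap_places) (simp add: swap_places_def)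
  show "\<not> length_less (digit p (Suc i)) (digit p i) \<Longrightarrow> L_A r n (swap_places i p) = Suc (L_A r n p)"
    using swap(2) by (simp add: L_A_def inversions_def digit_swap_places) (simp add: swap_places_def)
qed

text \<open>Only the halved color of the first digit changes. The additive form avoids truncated
  subtraction.\<close>

lemma L_A_recolor:
  assumes n: "n > 0" and perm: "snd p permutes {1..n}"
  shows "L_A r n (recolor r k p) + half_mod r (fst p (snd p 1)) =
    L_A r n p + half_mod r ((fst p (snd p 1) + k) mod r)"
proof -
  have d: "snd p 1 \<in> {1..n}"
    using permutes_in_image[OF perm, of 1] n by simp
  have "color_inversions n (recolor r k p) = color_inversions n p"
    using n perm by (intro color_inversions_cong) (auto simp: recolor_def)
  moreover have "(\<Sum>i \<in> {1..n} - {snd p 1}. half_mod r (fst (recolor r k p) i)) =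
      (\<Sum>i \<in> {1..n} - {snd p 1}. half_mod r (fst p i))"
    by (intro sum.cong) (auto simp: recolor_def)
  ultimately show ?thesis
    using sum.remove[OF _ d, of "\<lambda>i. half_mod r (fst (recolor r k p) i)"]
      sum.remove[OF _ d, of "\<lambda>i. half_mod r (fst p i)"]
    by (simp add: L_A_eq recolor_def)
qed


section \<open>Halving colors\<close>

text \<open>For odd \<open>h\<close>, \<open>(h + 1) div 2\<close> is the inverse of 2 modulo
  \<open>h\<close>, which merges the two parity cases into one linear map.\<close>

lemma half_mod_eq:
  assumes "odd h"
  shows "half_mod (2 * h) c = (c * ((h + 1) div 2)) mod h"
proof -
  obtain m where m: "h = 2 * m + 1" using assms by (auto elim: oddE)
  show ?thesis
  proof (cases "even c")
    case True
    then obtain k where k: "c = 2 * k" by (auto elim: evenE)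
    have "c * ((h + 1) div 2) = k + k * h"
      by (simp add: k m algebra_simps)
    then show ?thesis using k by (simp add: half_mod_def)
  next
    case False
    then obtain k where k: "c = 2 * k + 1" by (auto elim: oddE)
    have "c * ((h + 1) div 2) = (k + m + 1) + k * h"
      by (simp add: k m algebra_simps)
    moreover have "half_mod (2 * h) c = (k + m + 1) mod h"
      by (simp add: half_mod_def k m)
    ultimately show ?thesis by (metis mod_mult_self1)
  qed
qed

text \<open>Colors are reduced modulo \<open>2 * h\<close>, which is harmless for a map that factors
  through residues modulo \<open>h\<close>.\<close>

lemma half_mod_mod:
  assumes "odd h"
  shows "half_mod (2 * h) (c mod (2 * h)) = half_mod (2 * h) c"
proof -
  have "c mod (2 * h) mod h = c mod h"
    by (simp add: mod_mod_cancel)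
  then show ?thesis
    unfolding half_mod_eq[OF assms] by (rule mod_mult_cong) simp
qed

lemma half_mod_add_half:
  assumes "odd h"
  shows "half_mod (2 * h) ((c + h) mod (2 * h)) = half_mod (2 * h) c"
  by (simp only: half_mod_mod[OF assms]) (simp add: half_mod_eq[OF assms] add_mult_distrib)

lemma half_mod_add_2:
  assumes "odd h"
  shows "half_mod (2 * h) ((c + 2) mod (2 * h)) = Suc (half_mod (2 * h) c) mod h"
proof -
  \<comment> \<open>Twice the multiplier is \<open>h + 1\<close>, hence 1 modulo
    \<open>h\<close>.\<close>
  have "(c + 2) * ((h + 1) div 2) = Suc (c * ((h + 1) div 2)) + h"
    using assms by (auto elim!: oddE simp: algebra_simps)
  then have "(c + 2) * ((h + 1) div 2) mod h = Suc (c * ((h + 1) div 2)) mod h"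
    by (metis mod_add_self2)
  then show ?thesis
    by (simp only: half_mod_mod[OF assms]) (simp only: half_mod_eq[OF assms] mod_Suc_eq)
qed

lemma half_mod_eq_0:
  assumes "odd h" "c < 2 * h" "half_mod (2 * h) c = 0"
  shows "c = 0 \<or> c = h"
proof -
  have "h dvd c * ((h + 1) div 2)"
    using assms by (auto simp: half_mod_eq)
  \<comment> \<open>The multiplier divides \<open>h + 1\<close>, which is coprime to
    \<open>h\<close>.\<close>
  moreover have "coprime h ((h + 1) div 2)"
  proof -
    have "coprime h (h + 1)" by simp
    moreover have "h + 1 = (h + 1) div 2 * 2" using assms(1) by presburger
    ultimately show ?thesis by (metis coprime_mult_right_iff)
  qed
  ultimately have "h dvd c"
    by (simp add: coprime_dvd_mult_left_iff)
  then obtain k where "c = h * k" ..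
  then show ?thesis using assms(2) by (cases k) auto
qed


section \<open>The alternating subgroup\<close>

lemma increasing_permutes_id:
  fixes \<tau> :: "nat \<Rightarrow> nat"
  assumes perm: "\<tau> permutes {1..n}" and inc: "\<And>i. 1 \<le> i \<Longrightarrow> i < n \<Longrightarrow> \<tau> i < \<tau> (Suc i)"
  shows "\<tau> = id"
proof -
  have "1 \<le> i \<Longrightarrow> i \<le> n \<Longrightarrow> i \<le> \<tau> i" for i
  proof (induction i rule: nat_induct_at_least)
    case base
    then show ?case using permutes_in_image[OF perm, of 1] by simp
  next
    case (Suc i)
    then show ?case using inc[of i] by simp
  qed
  then show ?thesis
    using permutes_natset_ge[OF perm] by auto
qed

text \<open>Uncolored digits lie above all colored ones. An uncolored first digit therefore forces
  every later digit to be uncolored, and the underlying permutation to increase.\<close>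

lemma no_descent_imp_one:
  assumes p: "p \<in> carrier (cperm_group r n)" and c: "fst p (snd p 1) = 0"
    and inc: "\<And>i. 1 \<le> i \<Longrightarrow> i < n \<Longrightarrow> \<not> length_less (digit p (Suc i)) (digit p i)"
  shows "p = \<one>\<^bsub>cperm_group r n\<^esub>"
proof -
  have perm: "snd p permutes {1..n}"
    using p by (simp add: cperm_group_simps)
  have less: "length_less (digit p i) (digit p (Suc i))" if "1 \<le> i" "i < n" for i
    using inc[OF that] length_less_total[of "snd p i" "snd p (Suc i)"]
      inj_eq[OF permutes_inj[OF perm]] unfolding digit_def by auto
  have zero: "1 \<le> i \<Longrightarrow> i \<le> n \<Longrightarrow> fst p (snd p i) = 0" for i
  proof (induction i rule: nat_induct_at_least)
    case (Suc i)
    then show ?case using less[of i] by (auto simp: digit_def split: if_splits)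
  qed (use c in simp)
  have "snd p = id"
    using less zero by (intro increasing_permutes_id[OF perm]) (simp add: digit_def)
  then have "restrict (fst p) {1..n} = (\<lambda>i\<in>{1..n}. 0)"
    using zero by (intro restrict_ext) auto
  then show ?thesis
    using cperm_fst_restrict[OF p] \<open>snd p = id\<close> by (simp add: cperm_group_simps prod_eq_iff)
qed

section \<open>The sign character made explicit, and its kernel\<close>

lemma sign_char_eq:
  assumes "even r" "r > 0"
  shows "sign_char r n = color_sum_sign r n"
  unfolding sign_char_def
  using is_sign_char_color_sum_sign[OF assms] sign_char_ex1[OF assms] by (metis the1_equality)

lemma sign_char_hom:
  assumes "even r" "r > 0"
  shows "group_hom (cperm_group r n) sign_img (sign_char r n)"
  using is_sign_char_color_sum_sign[OF assms] cperm_group_is_group[OF assms(2)] sign_img_is_group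
  by (simp add: sign_char_eq[OF assms] is_sign_char_def group_hom_def group_hom_axioms_def)

lemma alt_cperms_iff:
  "p \<in> alt_cperms r n \<longleftrightarrow> p \<in> carrier (cperm_group r n) \<and> sign_char r n p = 1"
  by (auto simp: alt_cperms_def kernel_def sign_img_def)

lemma alt_cperms_subgroup:
  "even r \<Longrightarrow> r > 0 \<Longrightarrow> subgroup (alt_cperms r n) (cperm_group r n)"
  unfolding alt_cperms_def by (rule group_hom.subgroup_kernel[OF sign_char_hom])

section \<open>The generators and their effect on the length for r = 2h, h odd\<close>

context
  fixes h n :: nat
  assumes h: "odd h" and n: "n > 0"
begin

abbreviation (input) "G \<equiv> cperm_group (2 * h) n"
abbreviation (input) "L \<equiv> L_A (2 * h) n"

lemma h_pos: "h > 0"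
  using h by (rule odd_pos)

interpretation G: group G
  using h_pos by (intro cperm_group_is_group) simp

lemma s_closed: "i < n \<Longrightarrow> cperm_s n i \<in> carrier G"
  using h_pos by (intro cperm_s_closed) auto

lemma sign_char_s_0_pow: "sign_char (2 * h) n (cperm_s n 0 [^]\<^bsub>G\<^esub> (k :: nat)) = (-1) ^ k"
proof -
  have "(\<Sum>i = 1..n. if i = 1 then k mod (2 * h) else 0) = k mod (2 * h)"
    using n by simp
  moreover have "cperm_s n 0 [^]\<^bsub>G\<^esub> k \<in> carrier G"
    using s_closed[OF n] by simp
  ultimately show ?thesis
    using h_pos
    by (simp add: sign_char_eq color_sum_sign_def cperm_s_0_pow sign_id uminus_power_if dvd_mod_iff)
qed

text \<open>For positive \<open>i\<close> the sign is \<open>(-1) ^ h * (-1)\<close>, which is 1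
  because \<open>h\<close> is odd.\<close>

lemma alt_gen_mem_alt:
  assumes "i < n"
  shows "alt_gen (2 * h) n i \<in> alt_cperms (2 * h) n"
proof (cases "i = 0")
  case True
  then show ?thesis
    using h_pos s_closed[OF n] by (simp add: alt_cperms_iff alt_gen_def sign_char_s_0_pow)
next
  case False
  have "is_sign_char (2 * h) n (sign_char (2 * h) n)"
    using is_sign_char_color_sum_sign[of "2 * h" n] h_pos by (simp add: sign_char_eq)
  then have "sign_char (2 * h) n (cperm_s n i) = -1"
    using assms by (simp add: is_sign_char_def)
  moreover have "sign_char (2 * h) n (cperm_s n 0 [^]\<^bsub>G\<^esub> h \<otimes>\<^bsub>G\<^esub> cperm_s n i) =
      sign_char (2 * h) n (cperm_s n 0 [^]\<^bsub>G\<^esub> h) * sign_char (2 * h) n (cperm_s n i)"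
    using group_hom.hom_mult[OF sign_char_hom, of "2 * h"] h_pos s_closed[OF n] s_closed[OF assms]
    by (simp add: sign_img_def)
  ultimately show ?thesis
    using False h h_pos s_closed[OF n] s_closed[OF assms]
    by (simp add: alt_cperms_iff alt_gen_def sign_char_s_0_pow)
qed

lemma alt_gen_closed: "i < n \<Longrightarrow> alt_gen (2 * h) n i \<in> carrier G"
  using alt_gen_mem_alt h_pos by (simp add: alt_cperms_iff)

lemma alt_gens_subset: "alt_gens (2 * h) n \<subseteq> alt_cperms (2 * h) n"
proof -
  have "inv\<^bsub>G\<^esub> (alt_gen (2 * h) n 1) \<in> alt_cperms (2 * h) n" if "n > 1"
    using that h_pos by (intro subgroup.m_inv_closed[OF alt_cperms_subgroup] alt_gen_mem_alt) simp_all
  then show ?thesis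
    using alt_gen_mem_alt by (auto simp: alt_gens_def)
qed

lemma mult_s_0_pow:
  "p \<in> carrier G \<Longrightarrow> p \<otimes>\<^bsub>G\<^esub> (cperm_s n 0 [^]\<^bsub>G\<^esub> (k :: nat)) = recolor (2 * h) k p"
  by (rule cperm_mult_s_0_pow[OF n]) (use h_pos in simp_all)

lemma recolor_closed:
  assumes "p \<in> carrier G"
  shows "recolor (2 * h) k p \<in> carrier G"
  unfolding mult_s_0_pow[OF assms, symmetric]
  by (intro G.m_closed G.nat_pow_closed assms s_closed n)

lemma mult_alt_gen_0: "p \<in> carrier G \<Longrightarrow> p \<otimes>\<^bsub>G\<^esub> alt_gen (2 * h) n 0 = recolor (2 * h) 2 p"
  by (simp add: alt_gen_def mult_s_0_pow)

lemma mult_alt_gen: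
  assumes "p \<in> carrier G" "1 \<le> i" "i < n"
  shows "p \<otimes>\<^bsub>G\<^esub> alt_gen (2 * h) n i = swap_places i (recolor (2 * h) h p)"
proof -
  have "p \<otimes>\<^bsub>G\<^esub> alt_gen (2 * h) n i = (p \<otimes>\<^bsub>G\<^esub> (cperm_s n 0 [^]\<^bsub>G\<^esub> h)) \<otimes>\<^bsub>G\<^esub> cperm_s n i"
    using assms G.m_assoc[OF assms(1) G.nat_pow_closed[OF s_closed[OF n]] s_closed[OF assms(3)]]
    by (simp add: alt_gen_def)
  also have "\<dots> = recolor (2 * h) h p \<otimes>\<^bsub>G\<^esub> cperm_s n i"
    by (simp only: mult_s_0_pow[OF assms(1)])
  also have "\<dots> = swap_places i (recolor (2 * h) h p)"
    using assms(2) by (intro cperm_mult_s[OF recolor_closed[OF assms(1)]]) simp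
  finally show ?thesis .
qed

lemma L_recolor_half: "p \<in> carrier G \<Longrightarrow> L (recolor (2 * h) h p) = L p"
  using L_A_recolor[OF n, of p "2 * h" h] half_mod_add_half[OF h] by (simp add: cperm_group_simps)

text \<open>The recoloring keeps the length and the swap changes it by exactly one. The second
  inequality serves the inverse of the generator with index 1.\<close>

lemma L_mult_alt_gen:
  assumes p: "p \<in> carrier G" and i: "1 \<le> i" "i < n"
  shows "L (p \<otimes>\<^bsub>G\<^esub> alt_gen (2 * h) n i) \<le> Suc (L p)"
    and "L p \<le> Suc (L (p \<otimes>\<^bsub>G\<^esub> alt_gen (2 * h) n i))"
proof -
  let ?p' = "recolor (2 * h) h p"
  have "L ?p' = Suc (L (swap_places i ?p')) \<or> L (swap_places i ?p') = Suc (L ?p')"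
    using L_A_swap_places[OF recolor_closed[OF p] i] by blast
  then show "L (p \<otimes>\<^bsub>G\<^esub> alt_gen (2 * h) n i) \<le> Suc (L p)"
    and "L p \<le> Suc (L (p \<otimes>\<^bsub>G\<^esub> alt_gen (2 * h) n i))"
    unfolding mult_alt_gen[OF assms] L_recolor_half[OF p] by linarith+
qed

lemma L_mult_gens:
  assumes p: "p \<in> carrier G" and a: "a \<in> alt_gens (2 * h) n"
  shows "L (p \<otimes>\<^bsub>G\<^esub> a) \<le> Suc (L p)"
proof -
  consider (zero) "a = alt_gen (2 * h) n 0" | (pos) i where "1 \<le> i" "i < n" "a = alt_gen (2 * h) n i"
    | (inv) "n > 1" "a = inv\<^bsub>G\<^esub> (alt_gen (2 * h) n 1)"
  proof -
    have "(\<exists>i<n. a = alt_gen (2 * h) n i) \<or> n > 1 \<and> a = inv\<^bsub>G\<^esub> (alt_gen (2 * h) n 1)"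
      using a unfolding alt_gens_def by (cases "n > 1") auto
    then show ?thesis
      using that by (metis less_one not_le)
  qed
  then show ?thesis
  proof cases
    case zero
    \<comment> \<open>A wrap-around modulo \<open>h\<close> can only lower the value.\<close>
    have "Suc (half_mod (2 * h) c) mod h \<le> Suc (half_mod (2 * h) c)" for c
      by (rule mod_less_eq_dividend)
    then have half_le: "half_mod (2 * h) ((c + 2) mod (2 * h)) \<le> Suc (half_mod (2 * h) c)" for c
      using half_mod_add_2[OF h] by metis
    have "snd p permutes {1..n}"
      using p by (simp add: cperm_group_simps)
    then have "L (recolor (2 * h) 2 p) \<le> Suc (L p)"
      using L_A_recolor[OF n, of p "2 * h" 2] half_le[of "fst p (snd p 1)"] by linarith
    then show ?thesis
      by (simp only: zero mult_alt_gen_0[OF p])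
  next
    case pos
    then show ?thesis using L_mult_alt_gen(1)[OF p] by simp
  next
    case inv
    let ?q = "p \<otimes>\<^bsub>G\<^esub> a"
    have "?q \<in> carrier G" "?q \<otimes>\<^bsub>G\<^esub> alt_gen (2 * h) n 1 = p"
      using inv p alt_gen_closed[of 1] by (simp_all add: G.m_assoc)
    then show ?thesis
      using L_mult_alt_gen(2)[of ?q 1] inv by simp
  qed
qed

text \<open>The last letter is the generator with index 0 if the halved first color is positive, the
  one with index \<open>i\<close> if \<open>p\<close> has a descent at \<open>i\<close>, and the
  inverse of the one with index 1 if the recolored \<open>?p'\<close> has a descent in the first
  place.\<close>

lemma L_descend:
  assumes p: "p \<in> alt_cperms (2 * h) n" and ne: "p \<noteq> \<one>\<^bsub>G\<^esub>"
  shows "\<exists>a\<in>alt_gens (2 * h) n. \<exists>q\<in>alt_cperms (2 * h) n. p = q \<otimes>\<^bsub>G\<^esub> a \<and> L q < L p"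
proof -
  have sub: "subgroup (alt_cperms (2 * h) n) G"
    using h_pos by (intro alt_cperms_subgroup) simp_all
  have pG: "p \<in> carrier G" and sgn: "sign_char (2 * h) n p = 1"
    using p h_pos by (simp_all add: alt_cperms_iff)
  have perm: "snd p permutes {1..n}"
    using pG by (simp add: cperm_group_simps)
  \<comment> \<open>Right division by a generator stays in the subgroup.\<close>
  have divide: "\<exists>q. q \<in> alt_cperms (2 * h) n \<and> q \<in> carrier G \<and> p = q \<otimes>\<^bsub>G\<^esub> alt_gen (2 * h) n i"
    if "i < n" for i
  proof (intro exI conjI)
    let ?q = "p \<otimes>\<^bsub>G\<^esub> inv\<^bsub>G\<^esub> (alt_gen (2 * h) n i)"
    show "?q \<in> alt_cperms (2 * h) n"
      using subgroup.m_closed[OF sub] subgroup.m_inv_closed[OF sub] p alt_gen_mem_alt[OF that]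
      by simp
    show "?q \<in> carrier G" "p = ?q \<otimes>\<^bsub>G\<^esub> alt_gen (2 * h) n i"
      using pG alt_gen_closed[OF that] by (simp_all add: G.m_assoc)
  qed
  let ?c = "fst p (snd p 1)"
  have c_less: "?c < 2 * h"
    using cperm_fst_less[OF pG] permutes_in_image[OF perm, of 1] n by simp
  let ?p' = "recolor (2 * h) h p"
  consider (color) "half_mod (2 * h) ?c \<noteq> 0"
    | (descent) i where "1 \<le> i" "i < n" "length_less (digit p (Suc i)) (digit p i)"
    | (first) "n > 1" "length_less (digit ?p' 2) (digit ?p' 1)"
    | (none) "half_mod (2 * h) ?c = 0"
      "\<And>i. 1 \<le> i \<Longrightarrow> i < n \<Longrightarrow> \<not> length_less (digit p (Suc i)) (digit p i)"
      "n > 1 \<Longrightarrow> \<not> length_less (digit ?p' 2) (digit ?p' 1)"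
    by blast
  then show ?thesis
  proof cases
    case color
    obtain q where q: "q \<in> alt_cperms (2 * h) n" "q \<in> carrier G" "p = q \<otimes>\<^bsub>G\<^esub> alt_gen (2 * h) n 0"
      using divide[OF n] by blast
    then have pq: "p = recolor (2 * h) 2 q"
      using mult_alt_gen_0 by simp
    let ?b = "half_mod (2 * h) (fst q (snd q 1))"
    have c: "half_mod (2 * h) ?c = Suc ?b mod h"
      using half_mod_add_2[OF h, of "fst q (snd q 1)"] by (simp add: pq recolor_def)
    have "?b < h"
      using h_pos by (simp add: half_mod_def)
    \<comment> \<open>A wrap-around would make the halved color of \<open>p\<close> zero, contrary
      to the case.\<close>
    then have "Suc ?b mod h = Suc ?b"
      using c color by (cases "Suc ?b = h") auto
    then have "L p = Suc (L q)"
      using L_A_recolor[OF n, of q "2 * h" 2] half_mod_add_2[OF h, of "fst q (snd q 1)"] q(2) pq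
      by (simp add: cperm_group_simps)
    moreover have "alt_gen (2 * h) n 0 \<in> alt_gens (2 * h) n"
      using n by (auto simp: alt_gens_def)
    ultimately show ?thesis
      using q by (metis lessI)
  next
    case descent
    obtain q where q: "q \<in> alt_cperms (2 * h) n" "q \<in> carrier G" "p = q \<otimes>\<^bsub>G\<^esub> alt_gen (2 * h) n i"
      using divide[OF descent(2)] by blast
    let ?q' = "recolor (2 * h) h q"
    have pq: "p = swap_places i ?q'"
      using mult_alt_gen q descent by simp
    \<comment> \<open>Undoing the swap turns the descent of \<open>p\<close> into an ascent of
      \<open>?q'\<close>, which has the same length as \<open>q\<close>.\<close>
    have "length_less (digit ?q' i) (digit ?q' (Suc i))"
      using descent(3) by (simp add: pq digit_swap_places)
    then have "\<not> length_less (digit ?q' (Suc i)) (digit ?q' i)"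
      unfolding digit_def by (auto split: if_splits)
    then have "L p = Suc (L q)"
      using L_A_swap_places(2)[OF recolor_closed[OF q(2)] descent(1,2)] L_recolor_half[OF q(2)] pq
      by simp
    moreover have "alt_gen (2 * h) n i \<in> alt_gens (2 * h) n"
      using descent by (auto simp: alt_gens_def)
    ultimately show ?thesis
      using q by (metis lessI)
  next
    case first
    let ?a = "alt_gen (2 * h) n 1"
    let ?q = "p \<otimes>\<^bsub>G\<^esub> ?a"
    have "?q = swap_places 1 ?p'"
      using mult_alt_gen[OF pG] first by simp
    then have "L p = Suc (L ?q)"
      using L_A_swap_places(1)[OF recolor_closed[OF pG], of 1 h] first L_recolor_half[OF pG]
      by (simp add: numeral_2_eq_2)
    moreover have "?q \<in> alt_cperms (2 * h) n"
      using subgroup.m_closed[OF sub] p alt_gen_mem_alt[OF first(1)] by simp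
    moreover have "p = ?q \<otimes>\<^bsub>G\<^esub> inv\<^bsub>G\<^esub> ?a"
      using pG alt_gen_closed[OF first(1)] by (simp add: G.m_assoc)
    moreover have "inv\<^bsub>G\<^esub> ?a \<in> alt_gens (2 * h) n"
      using first by (simp add: alt_gens_def)
    ultimately show ?thesis
      by (metis lessI)
  next
    case none
    have p': "?p' \<in> carrier G"
      using recolor_closed[OF pG] .
    \<comment> \<open>Recoloring affects place 1 only, so descents from the second place on are
      those of \<open>p\<close>.\<close>
    have desc': "\<not> length_less (digit ?p' (Suc i)) (digit ?p' i)" if "1 \<le> i" "i < n" for i
      using none(2)[OF that] none(3) that digit_recolor[OF perm] by (cases "i = 1") (auto simp: numeral_2_eq_2)
    have "?c \<noteq> 0"
      using no_descent_imp_one[OF pG] none(2) ne by blast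
    then have "?c = h"
      using half_mod_eq_0[OF h c_less none(1)] by simp
    \<comment> \<open>The new color is \<open>h + h\<close>, which vanishes modulo
      \<open>2 * h\<close>.\<close>
    then have "fst ?p' (snd ?p' 1) = 0"
      by (simp add: recolor_def flip: mult_2)
    then have "?p' = \<one>\<^bsub>G\<^esub>"
      using no_descent_imp_one[OF p'] desc' by blast
    then have "p \<otimes>\<^bsub>G\<^esub> (cperm_s n 0 [^]\<^bsub>G\<^esub> h) = \<one>\<^bsub>G\<^esub>"
      by (simp only: mult_s_0_pow[OF pG])
    then have "p = inv\<^bsub>G\<^esub> (cperm_s n 0 [^]\<^bsub>G\<^esub> h)"
      using pG s_closed[OF n] by (intro G.inv_equality[symmetric]) auto
    then have "cperm_s n 0 [^]\<^bsub>G\<^esub> h \<in> alt_cperms (2 * h) n"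
      using subgroup.m_inv_closed[OF sub p] s_closed[OF n] by simp
    \<comment> \<open>This power has sign \<open>(-1) ^ h = -1\<close>, so it is outside the
      kernel.\<close>
    then have False
      using sign_char_s_0_pow[of h] h h_pos by (simp add: alt_cperms_iff)
    then show ?thesis ..
  qed
qed

lemma L_one: "L \<one>\<^bsub>G\<^esub> = 0"
proof -
  have "{i \<in> {1..n}. fst \<one>\<^bsub>G\<^esub> i \<noteq> 0} = {}"
    by (auto simp: cperm_group_simps)
  moreover have "{(i, j). i \<in> {1..n} \<and> j \<in> {1..n} \<and> i < j \<and>
      length_less (digit \<one>\<^bsub>G\<^esub> j) (digit \<one>\<^bsub>G\<^esub> i)} = {}"
    by (auto simp: digit_def cperm_group_simps)
  moreover have "(\<Sum>i = 1..n. half_mod (2 * h) (fst \<one>\<^bsub>G\<^esub> i)) = 0"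
    by (auto simp: cperm_group_simps half_mod_def)
  ultimately show ?thesis
    unfolding L_A_def inversions_def by (simp only: sum.empty card.empty add_0)
qed

lemma word_length_eq_L:
  assumes "p \<in> alt_cperms (2 * h) n"
  shows "word_length G (alt_gens (2 * h) n) p = enat (L p)"
proof (rule G.word_length_eqI[where H = "alt_cperms (2 * h) n"])
  show "alt_gens (2 * h) n \<subseteq> carrier G"
    using alt_gens_subset h_pos by (auto simp: alt_cperms_iff)
qed (use L_one L_mult_gens L_descend assms in auto)

end

theorem corollary5p7:
  fixes r n :: nat and p :: cperm
  assumes "r > 0" and "n > 0" and "r mod 4 = 2"
    and "p \<in> alt_cperms r n"
  shows "word_length (cperm_group r n) (alt_gens r n) p = enat (L_A r n p)"
proof -
  have "r = 2 * (r div 2)" "odd (r div 2)"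
    using assms(3) by presburger+
  then show ?thesis
    using word_length_eq_L assms(2,4) by metis
qed

end
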